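(* Let $H_9$ be the simply connected Lie group with Lie algebra $\mathfrak h_9$. For $s_0,s_3,s_5>0$ and $s_1,s_2,s_4\in\mathbb R$ let $$\sigma=\begin{pmatrix}1&0&0&0&0&0\\0&1&0&0&0&0\\0&0&s_0&0&0&0\\0&0&0&1&0&0\\0&0&s_1&s_2&s_3&0\\0&0&0&0&s_4&s_5\end{pmatrix}$$ and let $g_\sigma=\sigma^T\sigma$ be the corresponding left-invariant metric on $H_9$. Then $g_\sigma$ has nontrivial index of symmetry if and only if $s_2=0$. In this case, the index of symmetry is $1$ and the distribution of symmetry is generated by the left-invariant field $Y=e_4$. In particular, $\mathfrak s$ is properly contained in the central distribution of $H_9$ (the left-invariant distribution given by the center $Z(\mathfrak h_9)$).
   Context: $\mathfrak h_9$ is the 6-dimensional real Lie algebra with basis $e_1,\dots,e_6$ and nonzero brackets (up to skew-symmetry) $[e_1,e_2]=-e_5$, $[e_5,e_1]=-e_6$, $[e_2,e_3]=-e_6$. The metric $g_\sigma$ is the left-invariant metric whose inner product on $\mathfrak h_9$ is $g_\sigma(e_i,e_j)=(\sigma^T\sigma)_{ij}$. For a left-invariant metric $g$ on this group the isotropy group of the isometry group is discrete, so every Killing field is right-invariant. For $X\in\mathfrak h$ let $X^*$ be the right-invariant field with $X^*_e=X_e$. The distribution of symmetry $\mathfrak s$ is the left-invariant distribution with $\mathfrak s_e=\{X_e: X\in\mathfrak h,\ (\nabla X^* )_e=0\}$, identified with a subspace $\mathfrak s\subset\mathfrak h$; equivalently, $Y\in\mathfrak s$ if and only if $g([X,Y],Z)+g([X,Z],Y)+g([Y,Z],X)=0$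 for all $X,Z\in\mathfrak h$. The index of symmetry is $i_{\mathfrak s}(H,g)=\dim\mathfrak s$; it is nontrivial if it is positive. *)

theory Defs
  imports "HOL-Analysis.Analysis"
begin

section \<open>The Lie algebra \<open>h9\<close> and its simply connected Lie group\<close>

text \<open>
  Both are carried by \<^typ>\<open>real^6\<close>, with basis \<open>e\<^sub>i = axis i 1\<close>. The index \<open>6\<close> is literally the
  element \<open>0\<close> of the numeral type \<open>6\<close>; the indices \<open>1, \<dots>, 6\<close> are distinct and exhaust the type.
\<close>

abbreviation e :: "6 \<Rightarrow> real^6"
  where "e i \<equiv> axis i 1"

definition h9_bracket :: "real^6 \<Rightarrow> real^6 \<Rightarrow> real^6"
  where "h9_bracket x y =
     - (x$1 * y$2 - x$2 * y$1) *\<^sub>R e 5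
     - (x$5 * y$1 - x$1 * y$5) *\<^sub>R e 6
     - (x$2 * y$3 - x$3 * y$2) *\<^sub>R e 6"

definition h9_center :: "(real^6) set"
  where "h9_center = {X. \<forall>Y. h9_bracket X Y = 0}"

text \<open>
  The Lie algebra is 3-step nilpotent, so its simply connected group is the vector space itself (the
  exponential map being the identity) with the Baker-Campbell-Hausdorff product, which terminates
  after the triple brackets. The neutral element is \<open>0\<close>, the inverse of \<open>p\<close> is \<open>- p\<close>, and the
  tangent space at each point is \<^typ>\<open>real^6\<close>.
\<close>

definition h9_mult :: "real^6 \<Rightarrow> real^6 \<Rightarrow> real^6"
  where "h9_mult x y = x + y + (1/2) *\<^sub>R h9_bracket x y
     + (1/12) *\<^sub>R (h9_bracket x (h9_bracket x y) + h9_bracket y (h9_bracket y x))"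

definition left_field :: "real^6 \<Rightarrow> real^6 \<Rightarrow> real^6"
  where "left_field X p = frechet_derivative (\<lambda>q. h9_mult p q) (at 0) X"

definition right_field :: "real^6 \<Rightarrow> real^6 \<Rightarrow> real^6"
  where "right_field X p = frechet_derivative (\<lambda>q. h9_mult q p) (at 0) X"

definition left_distribution :: "(real^6) set \<Rightarrow> real^6 \<Rightarrow> (real^6) set"
  where "left_distribution S p = (\<lambda>X. left_field X p) ` S"

text \<open>The left-invariant metric whose Gram matrix in the basis \<open>e\<^sub>i\<close> of the Lie algebra is \<open>G\<close>.\<close>

definition left_metric :: "real^6^6 \<Rightarrow> real^6 \<Rightarrow> real^6 \<Rightarrow> real^6 \<Rightarrow> real"
  where "left_metric G p v w =
    (let A = frechet_derivative (h9_mult (- p)) (at p) in A v \<bullet> (G *v A w))"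

section \<open>Levi-Civita connection of a metric on a Euclidean space\<close>

text \<open>
  A connection has the form \<open>\<nabla>\<^sub>v X = DX(v) + \<Gamma>(v, X)\<close> in the global chart; the Levi-Civita connection
  is the unique one which is torsion-free (\<open>\<Gamma>\<close> symmetric) and metric.
\<close>

definition christoffel ::
    "('a::euclidean_space \<Rightarrow> 'a \<Rightarrow> 'a \<Rightarrow> real) \<Rightarrow> 'a \<Rightarrow> 'a \<Rightarrow> 'a \<Rightarrow> 'a"
  where "christoffel g p = (THE \<Gamma>. bilinear \<Gamma> \<and> (\<forall>u v. \<Gamma> u v = \<Gamma> v u) \<and>
     (\<forall>u v w. frechet_derivative (\<lambda>q. g q v w) (at p) u = g p (\<Gamma> u v) w + g p v (\<Gamma> u w)))"

definition nabla ::
    "('a::euclidean_space \<Rightarrow> 'a \<Rightarrow> 'a \<Rightarrow> real) \<Rightarrow> ('a \<Rightarrow> 'a) \<Rightarrow> 'a \<Rightarrow> 'a \<Rightarrow> 'a"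
  where "nabla g X p v = frechet_derivative X (at p) v + christoffel g p v (X p)"

section \<open>Distribution and index of symmetry\<close>

definition symmetry_space :: "real^6^6 \<Rightarrow> (real^6) set"
  where "symmetry_space G = {X. \<forall>v. nabla (left_metric G) (right_field X) 0 v = 0}"

definition symmetry_distribution :: "real^6^6 \<Rightarrow> real^6 \<Rightarrow> (real^6) set"
  where "symmetry_distribution G = left_distribution (symmetry_space G)"

definition index_of_symmetry :: "real^6^6 \<Rightarrow> nat"
  where "index_of_symmetry G = dim (symmetry_space G)"

definition sigma :: "real \<Rightarrow> real \<Rightarrow> real \<Rightarrow> real \<Rightarrow> real \<Rightarrow> real \<Rightarrow> real^6^6"
  where "sigma s0 s1 s2 s3 s4 s5 = vector
    [vector [1, 0, 0,  0,  0,  0],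
     vector [0, 1, 0,  0,  0,  0],
     vector [0, 0, s0, 0,  0,  0],
     vector [0, 0, 0,  1,  0,  0],
     vector [0, 0, s1, s2, s3, 0],
     vector [0, 0, 0,  0,  s4, s5]]"

section \<open>Consistency of the conventions\<close>

lemma exhaust_6: "i = 1 \<or> i = 2 \<or> i = 3 \<or> i = 4 \<or> i = 5 \<or> i = 6" for i :: 6
proof (induct i)
  case (of_int z)
  then have "z = 0 \<or> z = 1 \<or> z = 2 \<or> z = 3 \<or> z = 4 \<or> z = 5"
    by simp presburger
  then show ?case by auto
qed

lemma forall_6: "(\<forall>i::6. P i) \<longleftrightarrow> P 1 \<and> P 2 \<and> P 3 \<and> P 4 \<and> P 5 \<and> P 6"
  by (metis exhaust_6)

lemma vector_6:
  fixes a1 :: "'a::zero"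
  shows "(vector [a1,a2,a3,a4,a5,a6] :: 'a^6) $ 1 = a1"
    and "(vector [a1,a2,a3,a4,a5,a6] :: 'a^6) $ 2 = a2"
    and "(vector [a1,a2,a3,a4,a5,a6] :: 'a^6) $ 3 = a3"
    and "(vector [a1,a2,a3,a4,a5,a6] :: 'a^6) $ 4 = a4"
    and "(vector [a1,a2,a3,a4,a5,a6] :: 'a^6) $ 5 = a5"
    and "(vector [a1,a2,a3,a4,a5,a6] :: 'a^6) $ 6 = a6"
  unfolding vector_def by simp_all

lemma h9_bracket_nth [simp]:
  "h9_bracket x y $ 1 = 0" "h9_bracket x y $ 2 = 0" "h9_bracket x y $ 3 = 0" "h9_bracket x y $ 4 = 0"
  "h9_bracket x y $ 5 = - (x$1 * y$2 - x$2 * y$1)"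
  "h9_bracket x y $ 6 = - (x$5 * y$1 - x$1 * y$5) - (x$2 * y$3 - x$3 * y$2)"
  by (simp_all add: h9_bracket_def axis_def)

lemmas h9_components = vector_add_component vector_minus_component vector_uminus_component
  vector_scaleR_component zero_index h9_bracket_nth real_scaleR_def

lemma h9_bracket_basis:
  "h9_bracket (e 1) (e 2) = - e 5"
  "h9_bracket (e 5) (e 1) = - e 6"
  "h9_bracket (e 2) (e 3) = - e 6"
  by (simp_all add: h9_bracket_def axis_def)

lemma h9_bracket_basis_zero:
  assumes "(i, j) \<notin> {(1, 2), (2, 1), (5, 1), (1, 5), (2, 3), (3, 2)}"
  shows "h9_bracket (e i) (e j) = 0"
  using assms exhaust_6[of i] exhaust_6[of j]
  by (elim disjE) (simp_all add: h9_bracket_def axis_def)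

lemma h9_lie_algebra:
  "bilinear h9_bracket"
  "h9_bracket x x = 0"
  "h9_bracket x (h9_bracket y z) + h9_bracket y (h9_bracket z x) + h9_bracket z (h9_bracket x y) = 0"
proof -
  show "bilinear h9_bracket"
    unfolding bilinear_def
    by (intro conjI allI linearI; unfold vec_eq_iff forall_6 h9_components; intro conjI; algebra)
  show "h9_bracket x x = 0"
    by (simp add: vec_eq_iff forall_6)
  show "h9_bracket x (h9_bracket y z) + h9_bracket y (h9_bracket z x)
      + h9_bracket z (h9_bracket x y) = 0"
    unfolding vec_eq_iff forall_6 h9_components by (intro conjI; algebra)
qed

lemma h9_group:
  "h9_mult (h9_mult x y) z = h9_mult x (h9_mult y z)"
  "h9_mult 0 x = x" "h9_mult x 0 = x"
  "h9_mult (- x) x = 0" "h9_mult x (- x) = 0"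
proof -
  show "h9_mult (h9_mult x y) z = h9_mult x (h9_mult y z)"
    unfolding h9_mult_def vec_eq_iff forall_6 h9_components
    by (intro conjI; algebra)
qed (simp_all add: h9_mult_def vec_eq_iff forall_6)

lemma bounded_bilinear_h9_bracket: "bounded_bilinear h9_bracket"
  using h9_lie_algebra(1) bilinear_conv_bounded_bilinear by blast

lemmas h9_derivative_rules =
  bounded_bilinear.FDERIV[OF bounded_bilinear_h9_bracket] has_derivative_add
  has_derivative_scaleR_right has_derivative_const has_derivative_ident

lemma h9_bracket_0 [simp]: "h9_bracket 0 x = 0" "h9_bracket x 0 = 0"
  by (simp_all add: vec_eq_iff forall_6)

lemma left_field_eq:
  "left_field X p = X + (1/2) *\<^sub>R h9_bracket p X + (1/12) *\<^sub>R h9_bracket p (h9_bracket p X)"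
proof -
  have "((\<lambda>q. h9_mult p q) has_derivative
      (\<lambda>X. X + (1/2) *\<^sub>R h9_bracket p X + (1/12) *\<^sub>R h9_bracket p (h9_bracket p X))) (at 0)"
    unfolding h9_mult_def
    by (rule has_derivative_eq_rhs, (rule h9_derivative_rules)+) (simp add: fun_eq_iff)
  then show ?thesis
    by (simp add: left_field_def frechet_derivative_at[symmetric])
qed

text \<open>The Lie algebra of left-invariant fields is the given one.\<close>

lemma left_field_lie_bracket:
  "frechet_derivative (left_field Y) (at p) (left_field X p)
     - frechet_derivative (left_field X) (at p) (left_field Y p)
   = left_field (h9_bracket X Y) p"
proof -
  have D: "frechet_derivative (left_field Z) (at p) = (\<lambda>v. (1/2) *\<^sub>R h9_bracket v Z
      + (1/12) *\<^sub>R (h9_bracket p (h9_bracket v Z) + h9_bracket v (h9_bracket p Z)))" for Z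
  proof (rule sym, rule frechet_derivative_at)
    show "(left_field Z has_derivative (\<lambda>v. (1/2) *\<^sub>R h9_bracket v Z
      + (1/12) *\<^sub>R (h9_bracket p (h9_bracket v Z) + h9_bracket v (h9_bracket p Z)))) (at p)"
      unfolding left_field_eq[abs_def]
      by (rule has_derivative_eq_rhs, (rule h9_derivative_rules)+) (simp add: fun_eq_iff)
  qed
  show ?thesis
    unfolding D left_field_eq
    unfolding vec_eq_iff forall_6 h9_components by (intro conjI; algebra)
qed

lemma fields_at_identity: "left_field X 0 = X" "right_field X 0 = X"
  by (simp_all add: left_field_def right_field_def h9_group frechet_derivative_ident)

end

theory Submission
  imports Defs
begin

text \<open>
  At the identity, the Koszul formula for the metric \<open>g\<close> and the right-invariant field \<open>X\<^sup>*\<close> reads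
  \<open>2 g(\<nabla>\<^sub>v X\<^sup>*, w) = g([X,v], w) - g([X,w], v) - g([v,w], X)\<close>, so \<open>X\<close> lies in the symmetry space if and
  only if the right-hand side vanishes for all \<open>v\<close>, \<open>w\<close> (\<open>christoffel_koszul\<close>, \<open>symmetry_space_iff\<close>).

  This forces \<open>X\<close> to be central. For the central vector \<open>w = e\<^sub>6\<close> the condition is
  \<open>g([X,v], e\<^sub>6) = 0\<close>. Since \<open>[X,e\<^sub>3] = - X\<^sub>2 e\<^sub>6\<close> and \<open>[X,e\<^sub>5] = X\<^sub>1 e\<^sub>6\<close>, it yields \<open>X\<^sub>1 = X\<^sub>2 = 0\<close>; after
  that \<open>[X,e\<^sub>2] = X\<^sub>3 e\<^sub>6\<close> and \<open>[X,e\<^sub>1] = - X\<^sub>5 e\<^sub>6\<close>, which yields \<open>X\<^sub>3 = X\<^sub>5 = 0\<close>.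

  For a central \<open>X = X\<^sub>4 e\<^sub>4 + X\<^sub>6 e\<^sub>6\<close> only \<open>g([v,w], X) = 0\<close> is left: \<open>X\<close> must be orthogonal to the
  commutator algebra, which is spanned by \<open>e\<^sub>5\<close> and \<open>e\<^sub>6\<close>. As \<open>g(e\<^sub>4,e\<^sub>6) = 0\<close> and \<open>g(e\<^sub>6,e\<^sub>6) = s5\<^sup>2\<close>,
  orthogonality to \<open>e\<^sub>6\<close> gives \<open>X\<^sub>6 = 0\<close>; as \<open>g(e\<^sub>4,e\<^sub>5) = s2 * s3\<close>, orthogonality to \<open>e\<^sub>5\<close> then
  gives \<open>s2 * X\<^sub>4 = 0\<close>. So the symmetry space is the line through \<open>e\<^sub>4\<close> if \<open>s2 = 0\<close>, and trivial
  otherwise (\<open>symmetry_space_sigma\<close>). In the exponential chart the left-invariant field of a central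
  vector is constant, so the distributions at any point are the subspaces at the identity.
\<close>

section \<open>The Levi-Civita connection at a point\<close>

text \<open>
  Since the form need not be the inner product of the space, the representing vector comes from the
  endomorphism \<open>T\<close> with \<open>T z \<bullet> w = b z w\<close>: it is injective by nondegeneracy, hence surjective.
\<close>

lemma riesz_representation_nondegenerate:
  fixes b :: "'a::euclidean_space \<Rightarrow> 'a \<Rightarrow> real"
  assumes b: "bilinear b" and nondeg: "\<And>z. (\<And>w. b z w = 0) \<Longrightarrow> z = 0" and f: "linear f"
  shows "\<exists>z. \<forall>w. b z w = f w"
proof -
  define T where "T z = (\<Sum>k\<in>Basis. b z k *\<^sub>R k)" for z
  have T_inner: "T z \<bullet> w = b z w" for z w
  proof -
    have "b z w = b z (\<Sum>k\<in>Basis. (w \<bullet> k) *\<^sub>R k)"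
      by (simp add: euclidean_representation)
    also have "\<dots> = (\<Sum>k\<in>Basis. (w \<bullet> k) * b z k)"
      using b by (simp add: bilinear_def linear_sum linear_scale)
    finally show ?thesis
      by (simp add: T_def inner_sum_left inner_commute[of w] mult.commute)
  qed
  have "linear T"
    unfolding T_def using b
    by (intro linearI) (simp_all add: bilinear_ladd bilinear_lmul scaleR_add_left sum.distrib scaleR_sum_right)
  moreover have "inj T"
    unfolding linear_injective_0[OF \<open>linear T\<close>] using nondeg T_inner by (metis inner_zero_left)
  ultimately have "surj T"
    by (rule linear_inj_imp_surj)
  then obtain z where z: "T z = (\<Sum>k\<in>Basis. f k *\<^sub>R k)"
    by (metis surjD)
  have "b z w = f w" for w
  proof -
    have "f w = f (\<Sum>k\<in>Basis. (w \<bullet> k) *\<^sub>R k)"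
      by (simp add: euclidean_representation)
    also have "\<dots> = (\<Sum>k\<in>Basis. (w \<bullet> k) * f k)"
      using f by (simp add: linear_sum linear_scale)
    also have "\<dots> = T z \<bullet> w"
      by (simp add: z inner_sum_left inner_commute[of w] mult.commute)
    finally show ?thesis
      by (simp add: T_inner)
  qed
  then show ?thesis by blast
qed

text \<open>
  Only the metric and its first derivative \<open>D\<close> at the single point \<open>p\<close> enter. The Koszul formula
  determines every Levi-Civita \<open>\<Gamma>\<close>, which is uniqueness; the Riesz representation turns its
  right-hand side into a vector, which is existence.
\<close>

lemma christoffel_koszul:
  fixes g :: "'a::euclidean_space \<Rightarrow> 'a \<Rightarrow> 'a \<Rightarrow> real"
  assumes b: "bilinear (g p)" and sym: "\<And>v w. g p v w = g p w v"
    and nondeg: "\<And>z. (\<And>w. g p z w = 0) \<Longrightarrow> z = 0"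
    and D: "\<And>u v w. frechet_derivative (\<lambda>q. g q v w) (at p) u = D u v w"
    and D_sym: "\<And>u v w. D u v w = D u w v"
    and D_lin1: "\<And>v w. linear (\<lambda>u. D u v w)" and D_lin2: "\<And>u w. linear (\<lambda>v. D u v w)"
  shows "2 * g p (christoffel g p u v) w = D u v w + D v u w - D w u v"
proof -
  let ?LC = "\<lambda>\<Gamma>. bilinear \<Gamma> \<and> (\<forall>u v. \<Gamma> u v = \<Gamma> v u) \<and>
     (\<forall>u v w. frechet_derivative (\<lambda>q. g q v w) (at p) u = g p (\<Gamma> u v) w + g p v (\<Gamma> u w))"
  have D_lin3: "linear (D u v)" for u v
    using D_lin2[of u v] by (subst (asm) D_sym) simp
  note lin = D_lin1[THEN linear_add] D_lin1[THEN linear_scale] D_lin2[THEN linear_add]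
    D_lin2[THEN linear_scale] D_lin3[THEN linear_add] D_lin3[THEN linear_scale]
  note blin = bilinear_ladd[OF b] bilinear_lmul[OF b] bilinear_lsub[OF b]
  have cancel: "x = y" if "\<And>w. g p x w = g p y w" for x y
    using nondeg[of "x - y"] that by (simp add: blin)
  \<comment> \<open>In the alternating sum of the three metric equations, symmetry of \<open>\<Gamma>\<close> cancels all but one
    term, which occurs twice.\<close>
  have koszul: "2 * g p (\<Gamma> u v) w = D u v w + D v u w - D w u v" if "?LC \<Gamma>" for \<Gamma> u v w
  proof -
    have s: "\<Gamma> x y = \<Gamma> y x" and m: "D x y z = g p (\<Gamma> x y) z + g p (\<Gamma> x z) y" for x y z
      using that unfolding D by (auto simp: sym)
    show ?thesis
      unfolding m[of u v w] m[of v u w] m[of w u v] by (simp add: s[of v u] s[of w u] s[of w v])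
  qed
  have "\<exists>z. \<forall>w. g p z w = (D u v w + D v u w - D w u v) / 2" for u v
    by (rule riesz_representation_nondegenerate[OF b nondeg])
      (auto intro!: linearI simp: lin field_simps)
  then obtain \<Gamma> where \<Gamma>: "\<And>u v w. g p (\<Gamma> u v) w = (D u v w + D v u w - D w u v) / 2"
    by metis
  have "?LC \<Gamma>"
  proof (intro conjI allI)
    show "bilinear \<Gamma>"
      unfolding bilinear_def
      by (intro conjI allI linearI; rule cancel) (simp_all add: \<Gamma> blin lin field_simps)
    show "\<Gamma> u v = \<Gamma> v u" for u v
      by (rule cancel) (use D_sym in \<open>simp add: \<Gamma> field_simps\<close>)
    show "frechet_derivative (\<lambda>q. g q v w) (at p) u = g p (\<Gamma> u v) w + g p v (\<Gamma> u w)" for u v w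
      unfolding D sym[of v] \<Gamma> D_sym[of w u v] D_sym[of v u w] D_sym[of u w v]
      by (simp add: field_simps)
  qed
  moreover have "\<Gamma>' = \<Gamma>" if "?LC \<Gamma>'" for \<Gamma>'
  proof (intro ext cancel)
    show "g p (\<Gamma>' u v) w = g p (\<Gamma> u v) w" for u v w
      using koszul[OF that, of u v w] \<Gamma>[of u v w] by simp
  qed
  ultimately have "?LC (christoffel g p)"
    unfolding christoffel_def by (rule theI)
  then show ?thesis
    by (rule koszul)
qed

section \<open>Algebraic description of the symmetry space\<close>

text \<open>
  The map in front of \<open>v\<close> and \<open>w\<close> is the differential at \<open>p\<close> of the left translation by \<open>- p\<close>, that
  is, the series \<open>(1 - exp (- ad p)) / ad p\<close>, which stops at the quadratic term because the algebra
  is 3-step nilpotent.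
\<close>

lemma left_metric_eq:
  "left_metric G p v w =
    (v - (1/2) *\<^sub>R h9_bracket p v + (1/6) *\<^sub>R h9_bracket p (h9_bracket p v)) \<bullet>
    (G *v (w - (1/2) *\<^sub>R h9_bracket p w + (1/6) *\<^sub>R h9_bracket p (h9_bracket p w)))"
proof -
  have "(h9_mult (- p) has_derivative
      (\<lambda>v. v - (1/2) *\<^sub>R h9_bracket p v + (1/6) *\<^sub>R h9_bracket p (h9_bracket p v))) (at p)"
    unfolding h9_mult_def[abs_def]
    by (rule has_derivative_eq_rhs, (rule h9_derivative_rules)+)
      (simp add: fun_eq_iff vec_eq_iff forall_6 field_simps)
  then show ?thesis
    by (simp add: left_metric_def Let_def frechet_derivative_at[symmetric])
qed

lemma left_metric_derivative:
  "frechet_derivative (\<lambda>q. left_metric G q v w) (at 0) u =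
    - (1/2) * (h9_bracket u v \<bullet> (G *v w) + v \<bullet> (G *v h9_bracket u w))"
proof -
  note G = bounded_linear.has_derivative[OF matrix_vector_mul_bounded_linear[of G]]
  have "((\<lambda>q. left_metric G q v w) has_derivative
      (\<lambda>u. - (1/2) * (h9_bracket u v \<bullet> (G *v w) + v \<bullet> (G *v h9_bracket u w)))) (at 0)"
    unfolding left_metric_eq
    by (rule has_derivative_eq_rhs,
        (rule G has_derivative_inner has_derivative_diff h9_derivative_rules)+)
      (simp add: fun_eq_iff matrix_vector_mult_scaleR matrix_vector_mult_diff_distrib
        linear_neg[OF matrix_vector_mul_linear]
        inner_diff_left inner_diff_right field_simps)
  then show ?thesis
    by (simp add: frechet_derivative_at[symmetric])
qed

lemma right_field_derivative:
  "frechet_derivative (right_field X) (at 0) v = (1/2) *\<^sub>R h9_bracket X v"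
proof -
  have "right_field X p =
      X + (1/2) *\<^sub>R h9_bracket X p + (1/12) *\<^sub>R h9_bracket p (h9_bracket p X)" for p
  proof -
    have "((\<lambda>q. h9_mult q p) has_derivative (\<lambda>X. X + (1/2) *\<^sub>R h9_bracket X p
        + (1/12) *\<^sub>R h9_bracket p (h9_bracket p X))) (at 0)"
      unfolding h9_mult_def
      by (rule has_derivative_eq_rhs, (rule h9_derivative_rules)+) (simp add: fun_eq_iff)
    then show ?thesis
      by (simp add: right_field_def frechet_derivative_at[symmetric])
  qed
  then have "right_field X =
      (\<lambda>p. X + (1/2) *\<^sub>R h9_bracket X p + (1/12) *\<^sub>R h9_bracket p (h9_bracket p X))"
    by blast
  moreover have "(\<dots> has_derivative (\<lambda>v. (1/2) *\<^sub>R h9_bracket X v)) (at 0)"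
    by (rule has_derivative_eq_rhs, (rule h9_derivative_rules)+) (simp add: fun_eq_iff)
  ultimately show ?thesis
    by (simp add: frechet_derivative_at[symmetric])
qed

text \<open>
  The Koszul formula gives \<open>2 g(\<Gamma> v X, w) = - g([X,w], v) - g([v,w], X)\<close>, and the derivative of the
  right-invariant field in direction \<open>v\<close> is \<open>[X,v] / 2\<close>, which contributes the left-hand side below.
\<close>

lemma symmetry_space_iff:
  assumes sym: "\<And>v w. v \<bullet> (G *v w) = w \<bullet> (G *v v)"
    and nondeg: "\<And>z. (\<And>w. z \<bullet> (G *v w) = 0) \<Longrightarrow> z = 0"
  shows "X \<in> symmetry_space G \<longleftrightarrow>
    (\<forall>v w. h9_bracket X v \<bullet> (G *v w) = h9_bracket X w \<bullet> (G *v v) + h9_bracket v w \<bullet> (G *v X))"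
proof -
  let ?g = "left_metric G"
  note br = h9_lie_algebra(1)
  have anti: "h9_bracket x y = - h9_bracket y x" for x y
    by (simp add: vec_eq_iff forall_6)
  have g0: "?g 0 v w = v \<bullet> (G *v w)" for v w
    by (simp add: left_metric_eq)
  have K: "2 * ?g 0 (christoffel ?g 0 u v) w =
      - (1/2) * (h9_bracket u v \<bullet> (G *v w) + v \<bullet> (G *v h9_bracket u w))
      + - (1/2) * (h9_bracket v u \<bullet> (G *v w) + u \<bullet> (G *v h9_bracket v w))
      - - (1/2) * (h9_bracket w u \<bullet> (G *v v) + u \<bullet> (G *v h9_bracket w v))" for u v w
  proof (rule christoffel_koszul[OF _ _ _ left_metric_derivative])
    show "bilinear (?g 0)"
      unfolding bilinear_def g0
      by (auto intro!: linearI simp: inner_add_left inner_add_right matrix_vector_right_distrib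
          matrix_vector_mult_scaleR)
    show "?g 0 v w = ?g 0 w v" for v w
      using sym by (simp add: g0)
    show "z = 0" if "\<And>w. ?g 0 z w = 0" for z
      using nondeg that by (simp add: g0)
    show "- (1/2) * (h9_bracket u v \<bullet> (G *v w) + v \<bullet> (G *v h9_bracket u w))
        = - (1/2) * (h9_bracket u w \<bullet> (G *v v) + w \<bullet> (G *v h9_bracket u v))" for u v w
      using sym[of v] sym[of w] by simp
  qed (auto intro!: linearI simp: inner_add_left inner_add_right matrix_vector_right_distrib
      matrix_vector_mult_scaleR bilinear_ladd[OF br] bilinear_radd[OF br] bilinear_lmul[OF br]
      bilinear_rmul[OF br] field_simps)
  have N: "nabla ?g (right_field X) 0 v \<bullet> (G *v w) = (1/2) *
      (h9_bracket X v \<bullet> (G *v w) - h9_bracket X w \<bullet> (G *v v) - h9_bracket v w \<bullet> (G *v X))" for v w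
  proof -
    have "2 * (christoffel ?g 0 v X \<bullet> (G *v w)) =
        - (h9_bracket v w \<bullet> (G *v X)) - h9_bracket X w \<bullet> (G *v v)"
      using K[of v X w] sym[of "h9_bracket v w" X] sym[of "h9_bracket X w" v]
      unfolding g0 anti[of X v] anti[of w v] anti[of w X]
      by (simp add: linear_neg[OF matrix_vector_mul_linear] field_simps)
    then show ?thesis
      by (simp add: nabla_def right_field_derivative fields_at_identity inner_add_left)
  qed
  have "nabla ?g (right_field X) 0 v = 0 \<longleftrightarrow>
      (\<forall>w. nabla ?g (right_field X) 0 v \<bullet> (G *v w) = 0)" for v
    using nondeg by auto
  then show ?thesis
    unfolding symmetry_space_def mem_Collect_eq by (simp add: N algebra_simps)
qed

section \<open>The metrics \<open>g\<^sub>\<sigma>\<close>\<close>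

lemma sum_6: "sum f (UNIV::6 set) = f 1 + f 2 + f 3 + f 4 + f 5 + f 6"
proof -
  have UNIV: "(UNIV::6 set) = {1, 2, 3, 4, 5, 6}"
    using exhaust_6 by auto
  show ?thesis
    unfolding UNIV by (simp add: add.assoc)
qed

lemma sigma_mult_nth:
  "(sigma s0 s1 s2 s3 s4 s5 *v x) $ 1 = x $ 1"
  "(sigma s0 s1 s2 s3 s4 s5 *v x) $ 2 = x $ 2"
  "(sigma s0 s1 s2 s3 s4 s5 *v x) $ 3 = s0 * x $ 3"
  "(sigma s0 s1 s2 s3 s4 s5 *v x) $ 4 = x $ 4"
  "(sigma s0 s1 s2 s3 s4 s5 *v x) $ 5 = s1 * x $ 3 + s2 * x $ 4 + s3 * x $ 5"
  "(sigma s0 s1 s2 s3 s4 s5 *v x) $ 6 = s4 * x $ 5 + s5 * x $ 6"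
  unfolding matrix_vector_mult_def sigma_def by (simp_all add: sum_6 vector_6)

lemma inner_gram:
  fixes A :: "real^'n^'m"
  shows "v \<bullet> ((transpose A ** A) *v w) = (A *v v) \<bullet> (A *v w)"
  by (metis dot_lmul_matrix matrix_vector_mul_assoc transpose_matrix_vector inner_commute)

lemma symmetry_space_sigma:
  assumes "s0 > 0" "s3 > 0" "s5 > 0"
  shows "symmetry_space (transpose (sigma s0 s1 s2 s3 s4 s5) ** sigma s0 s1 s2 s3 s4 s5)
    = (if s2 = 0 then span {e 4} else {0})"
proof -
  let ?S = "sigma s0 s1 s2 s3 s4 s5"
  define h where "h X v w \<longleftrightarrow> (?S *v h9_bracket X v) \<bullet> (?S *v w)
      = (?S *v h9_bracket X w) \<bullet> (?S *v v) + (?S *v h9_bracket v w) \<bullet> (?S *v X)" for X v w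
  have inj: "z = 0" if "?S *v z = 0" for z
    using that assms unfolding vec_eq_iff forall_6 by (auto simp: sigma_mult_nth)
  have iff: "X \<in> symmetry_space (transpose ?S ** ?S) \<longleftrightarrow> (\<forall>v w. h X v w)" for X
  proof (rule trans[OF symmetry_space_iff])
    show "v \<bullet> ((transpose ?S ** ?S) *v w) = w \<bullet> ((transpose ?S ** ?S) *v v)" for v w
      unfolding inner_gram by (rule inner_commute)
    show "z = 0" if "\<And>w. z \<bullet> ((transpose ?S ** ?S) *v w) = 0" for z
      using that[of z] unfolding inner_gram inner_eq_zero_iff by (rule inj)
  qed (simp only: h_def inner_gram)
  note components = h_def inner_vec_def sum_6 sigma_mult_nth
  note comps = components axis_def
  have "(\<forall>v w. h X v w) \<longleftrightarrow> X $ 1 = 0 \<and> X $ 2 = 0 \<and> X $ 3 = 0 \<and> X $ 5 = 0 \<and> X $ 6 = 0 \<and> s2 * X $ 4 = 0"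
    (is "?L \<longleftrightarrow> ?R") for X
  proof
    assume h: ?L
    \<comment> \<open>Pairing with the central vector \<open>e\<^sub>6\<close> leaves only \<open>g([X,v], e\<^sub>6) = 0\<close>.\<close>
    have x2: "X $ 2 = 0"
      using h[rule_format, of "e 3" "e 6"] assms by (simp add: comps)
    have x1: "X $ 1 = 0"
      using h[rule_format, of "e 5" "e 6"] assms by (simp add: comps)
    have x3: "X $ 3 = 0"
      using h[rule_format, of "e 2" "e 6"] assms x1 by (simp add: comps)
    have x5: "X $ 5 = 0"
      using h[rule_format, of "e 1" "e 6"] assms x2 by (simp add: comps)
    \<comment> \<open>Now \<open>X\<close> is central, hence orthogonal to \<open>[e\<^sub>2,e\<^sub>3] = - e\<^sub>6\<close> and \<open>[e\<^sub>1,e\<^sub>2] = - e\<^sub>5\<close>.\<close>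
    have x6: "X $ 6 = 0"
      using h[rule_format, of "e 2" "e 3"] assms x1 x2 x3 x5 by (simp add: comps)
    have x4: "s2 * X $ 4 = 0"
      using h[rule_format, of "e 1" "e 2"] assms x1 x2 x3 x5 x6 by (simp add: comps)
    show ?R
      using x1 x2 x3 x4 x5 x6 by blast
  next
    assume ?R
    then show ?L
      by (auto simp: components)
  qed
  then have mem: "X \<in> symmetry_space (transpose ?S ** ?S) \<longleftrightarrow>
      X $ 1 = 0 \<and> X $ 2 = 0 \<and> X $ 3 = 0 \<and> X $ 5 = 0 \<and> X $ 6 = 0 \<and> s2 * X $ 4 = 0" for X
    unfolding iff .
  have span: "X \<in> span {e 4} \<longleftrightarrow> X $ 1 = 0 \<and> X $ 2 = 0 \<and> X $ 3 = 0 \<and> X $ 5 = 0 \<and> X $ 6 = 0" for X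
    unfolding span_singleton image_iff vec_eq_iff forall_6 by (auto simp: axis_def)
  show ?thesis
  proof (rule set_eqI)
    show "X \<in> symmetry_space (transpose ?S ** ?S) \<longleftrightarrow> X \<in> (if s2 = 0 then span {e 4} else {0})" for X
      unfolding mem by (auto simp: span vec_eq_iff forall_6)
  qed
qed

theorem theorem6p2:
  fixes s0 s1 s2 s3 s4 s5 :: real and G :: "real^6^6"
  assumes "s0 > 0" and "s3 > 0" and "s5 > 0"
  defines "G \<equiv> transpose (sigma s0 s1 s2 s3 s4 s5) ** sigma s0 s1 s2 s3 s4 s5"
  shows "(index_of_symmetry G > 0 \<longleftrightarrow> s2 = 0)
    \<and> (s2 = 0 \<longrightarrow> index_of_symmetry G = 1
        \<and> (\<forall>p. symmetry_distribution G p = span {left_field (e 4) p}))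
    \<and> (\<forall>p. symmetry_distribution G p \<subset> left_distribution h9_center p)"
proof -
  note S = symmetry_space_sigma[OF assms(1-3), of s1 s2 s4, folded G_def]
  have e4: "e 4 \<noteq> (0 :: real^6)"
    by simp
  have e4c: "e 4 \<in> h9_center" and e6c: "e 6 \<in> h9_center"
    by (auto simp: h9_center_def h9_bracket_def axis_def)
  have c: "left_field X p = X" if "X \<in> h9_center" for X p
  proof -
    have "h9_bracket p X = - h9_bracket X p"
      by (simp add: vec_eq_iff forall_6)
    also have "\<dots> = 0"
      using that by (simp add: h9_center_def)
    finally show ?thesis
      by (simp add: left_field_eq)
  qed
  then have LD: "left_distribution S p = S" if "S \<subseteq> h9_center" for S p
    unfolding left_distribution_def using that by (force simp: image_iff subset_iff)
  have sub: "span {e 4} \<subseteq> h9_center"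
    unfolding span_singleton by (auto simp: h9_center_def vec_eq_iff forall_6 axis_def)
  have e6: "e 6 \<notin> span {e 4 :: real^6}"
    unfolding span_singleton by (auto simp: vec_eq_iff forall_6 axis_def)
  have sym_sub: "symmetry_space G \<subseteq> span {e 4}"
    unfolding S by (simp add: span_zero)
  have "symmetry_distribution G p = symmetry_space G" for p
    unfolding symmetry_distribution_def using LD sym_sub sub by blast
  moreover have "left_distribution h9_center p = h9_center" for p
    using LD by blast
  moreover have "symmetry_space G \<subset> h9_center"
    using sym_sub sub e6 e6c by blast
  ultimately show ?thesis
    using e4 by (simp add: index_of_symmetry_def S c[OF e4c])
qed

end
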